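(* Let $H_0\colon D(H_0)\subseteq\mathcal{H}\to\mathcal{H}$ be a densely defined, closed, skew-symmetric operator on a Hilbert space $\mathcal{H}$. Let $\mathcal{G}_1:=\ker(1-H_0^\star)$, $\mathcal{G}_2:=\ker(1+H_0^\star)$, and for $j\in\{1,2\}$ let $P_j\colon D(H_0^\star)\to\mathcal{G}_j$ be the projection according to the direct decomposition $D(H_0^\star)=D(H_0)\,\dot+\,\mathcal{G}_1\,\dot+\,\mathcal{G}_2$. Let $\Omega$ be the standard symmetric form on $\mathcal{H}\oplus\mathcal{H}$, let $\omega$ be the standard unitary form on $\mathcal{G}_1\oplus\mathcal{G}_2$, and let $F\colon\operatorname{Graph}(H_0^\star)\to\mathcal{G}_1\oplus\mathcal{G}_2$ be defined by $$F(x,H_0^{\star}x)=(\sqrt{2}\,P_1x,\sqrt{2}\,P_2x).$$ Then $(\Omega,\mathcal{G}_1,\mathcal{G}_2,F,\omega)$ is a boundary system for $H_0$.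
   Context: $H_0$ is skew-symmetric if $H_0\subseteq -H_0^\star$. The spaces $\mathcal{G}_1,\mathcal{G}_2$ carry the inner product of $\mathcal{H}$. The direct (algebraic) decomposition $D(H_0^\star)=D(H_0)\,\dot+\,\ker(1-H_0^\star)\,\dot+\,\ker(1+H_0^\star)$ is a known fact for densely defined closed skew-symmetric $H_0$. Boundary system for $H_0$: a quintuple $(\Omega,\mathcal{G}_1,\mathcal{G}_2,F,\omega)$ where $\Omega$ is a sesquilinear form on $\mathcal{H}\oplus\mathcal{H}$, $\mathcal{G}_1,\mathcal{G}_2$ are Hilbert spaces, $\omega$ is a sesquilinear form on $\mathcal{G}_1\oplus\mathcal{G}_2$, and $F\colon\operatorname{Graph}(H_0^{\star})\to\mathcal{G}_1\oplus\mathcal{G}_2$ is a surjective map such that $\Omega((x,H_0^{\star}x),(y,H_0^{\star}y))=\omega(F(x,H_0^{\star}x),F(y,H_0^{\star}y))$ for all $x,y\in D(H_0^{\star})$. Standard symmetric form on $\mathcal{H}\oplus\mathcal{H}$: $\Omega((x,y),(u,v))=(x,v)_{\mathcal{H}}+(y,u)_{\mathcal{H}}$. Standard unitary form on $\mathcal{G}_1\oplus\mathcal{G}_2$: $\omega((x,y),(u,v))=(x,u)_{\mathcal{G}_1}-(y,v)_{\mathcal{G}_2}$. *)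

theory Defs
  imports "HOL-Analysis.Analysis"
begin

section \<open>Complex Hilbert spaces\<close>

class complex_vector = real_vector +
  fixes scaleC :: "complex \<Rightarrow> 'a \<Rightarrow> 'a" (infixr "*\<^sub>C" 75)
  assumes scaleC_add_right: "c *\<^sub>C (x + y) = c *\<^sub>C x + c *\<^sub>C y"
    and scaleC_add_left: "(c + d) *\<^sub>C x = c *\<^sub>C x + d *\<^sub>C x"
    and scaleC_scaleC: "c *\<^sub>C d *\<^sub>C x = (c * d) *\<^sub>C x"
    and scaleC_of_real: "complex_of_real r *\<^sub>C x = r *\<^sub>R x"

global_interpretation complex_vector:
  vector_space "scaleC :: complex \<Rightarrow> 'a \<Rightarrow> 'a::complex_vector"
  defines csubspace = complex_vector.subspace
proof
  show "1 *\<^sub>C x = x" for x :: 'a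
    using scaleC_of_real[of 1 x] by simp
qed (simp_all add: scaleC_add_right scaleC_add_left scaleC_scaleC)

text \<open>The complex inner product is linear in its first argument. Norm and topology are those
  of the underlying real inner product space, whose inner product is the real part of the
  complex one; hence \<open>cinner x x = of_real (norm x ^ 2)\<close>.\<close>

class complex_inner = complex_vector + real_inner +
  fixes cinner :: "'a \<Rightarrow> 'a \<Rightarrow> complex"
  assumes cinner_commute: "cinner x y = cnj (cinner y x)"
    and cinner_add_left: "cinner (x + y) z = cinner x z + cinner y z"
    and cinner_scaleC_left: "cinner (c *\<^sub>C x) y = c * cinner x y"
    and Re_cinner: "Re (cinner x y) = inner x y"

class chilbert_space = complex_inner + complete_space

instantiation complex :: chilbert_space
begin

definition scaleC_complex_def: "c *\<^sub>C (x::complex) = c * x"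
definition cinner_complex_def: "cinner (x::complex) y = x * cnj y"

instance
  by standard
    (simp_all add: scaleC_complex_def cinner_complex_def inner_complex_def algebra_simps
      scaleR_conv_of_real)

end

text \<open>Orthogonal direct sums.\<close>

instantiation prod :: (complex_vector, complex_vector) complex_vector
begin

definition scaleC_prod_def: "c *\<^sub>C p = (c *\<^sub>C fst p, c *\<^sub>C snd p)"

instance
  by standard
    (simp_all add: scaleC_prod_def prod_eq_iff scaleC_add_right scaleC_add_left scaleC_scaleC
      scaleC_of_real)

end

instantiation prod :: (complex_inner, complex_inner) complex_inner
begin

definition cinner_prod_def: "cinner p q = cinner (fst p) (fst q) + cinner (snd p) (snd q)"

instance
proof
  fix p q r :: "'a \<times> 'b" and c :: complex
  show "cinner p q = cnj (cinner q p)"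
    unfolding cinner_prod_def
    by (simp add: cinner_commute[of "fst p"] cinner_commute[of "snd p"])
  show "cinner (p + q) r = cinner p r + cinner q r"
    by (simp add: cinner_prod_def cinner_add_left)
  show "cinner (c *\<^sub>C p) q = c * cinner p q"
    by (simp add: cinner_prod_def scaleC_prod_def cinner_scaleC_left distrib_left)
  show "Re (cinner p q) = inner p q"
    by (simp add: cinner_prod_def Re_cinner inner_prod_def)
qed

end

instance prod :: (chilbert_space, chilbert_space) chilbert_space ..

text \<open>A set, with the operations and inner product of the ambient space, is a Hilbert space.
  As the ambient space may be chosen to be the Hilbert space itself, this is no restriction.\<close>

definition hilbert_on :: "'a::complex_inner set \<Rightarrow> bool" where
  "hilbert_on G \<longleftrightarrow> csubspace G \<and> complete G"

definition sesquilinear_on ::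
  "'a::complex_vector set \<Rightarrow> ('a \<Rightarrow> 'a \<Rightarrow> complex) \<Rightarrow> bool" where
  "sesquilinear_on S f \<longleftrightarrow> csubspace S \<and>
    (\<forall>x\<in>S. \<forall>y\<in>S. \<forall>z\<in>S. f (x + y) z = f x z + f y z \<and> f z (x + y) = f z x + f z y) \<and>
    (\<forall>x\<in>S. \<forall>y\<in>S. \<forall>c. f (c *\<^sub>C x) y = c * f x y \<and> f x (c *\<^sub>C y) = cnj c * f x y)"


section \<open>Unbounded operators\<close>

text \<open>An operator, possibly not everywhere defined, is identified with its graph. Its domain is
  its \<^const>\<open>Domain\<close>, the identity is \<^const>\<open>Id\<close>, extension of operators is set inclusion, and an
  operator is closed if and only if its graph is a \<^const>\<open>closed\<close> set.\<close>

definition linear_operator :: "('a::complex_vector \<times> 'b::complex_vector) set \<Rightarrow> bool" where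
  "linear_operator A \<longleftrightarrow> csubspace A \<and> single_valued A"

definition app :: "('a \<times> 'b) set \<Rightarrow> 'a \<Rightarrow> 'b" where
  "app A x = (THE y. (x, y) \<in> A)"

definition op_uminus :: "('a \<times> 'b::ab_group_add) set \<Rightarrow> ('a \<times> 'b) set" where
  "op_uminus A = {(x, - y) | x y. (x, y) \<in> A}"

definition op_plus :: "('a \<times> 'b::ab_group_add) set \<Rightarrow> ('a \<times> 'b) set \<Rightarrow> ('a \<times> 'b) set" where
  "op_plus A B = {(x, y + z) | x y z. (x, y) \<in> A \<and> (x, z) \<in> B}"

definition op_minus :: "('a \<times> 'b::ab_group_add) set \<Rightarrow> ('a \<times> 'b) set \<Rightarrow> ('a \<times> 'b) set" where
  "op_minus A B = {(x, y - z) | x y z. (x, y) \<in> A \<and> (x, z) \<in> B}"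

definition op_ker :: "('a \<times> 'b::zero) set \<Rightarrow> 'a set" where
  "op_ker A = {x. (x, 0) \<in> A}"

definition densely_defined :: "('a::topological_space \<times> 'b) set \<Rightarrow> bool" where
  "densely_defined A \<longleftrightarrow> closure (Domain A) = UNIV"

text \<open>Defined for arbitrary relations; single-valued if \<open>A\<close> is densely defined.\<close>

definition adjoint_op ::
  "('a::complex_inner \<times> 'b::complex_inner) set \<Rightarrow> ('b \<times> 'a) set" where
  "adjoint_op A = {(u, v). \<forall>(x, y)\<in>A. cinner y u = cinner x v}"

definition skew_symmetric :: "('a::complex_inner \<times> 'a) set \<Rightarrow> bool" where
  "skew_symmetric A \<longleftrightarrow> A \<subseteq> op_uminus (adjoint_op A)"

text \<open>The components of \<open>x\<close> in a direct (not necessarily orthogonal) sum of \<open>U\<close>, \<open>V\<close> and \<open>W\<close>;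
  meaningful only where the decomposition exists and is unique.\<close>

definition direct_sum_components ::
  "'a::ab_group_add set \<Rightarrow> 'a set \<Rightarrow> 'a set \<Rightarrow> 'a \<Rightarrow> 'a \<times> 'a \<times> 'a" where
  "direct_sum_components U V W x =
    (THE (u, v, w). u \<in> U \<and> v \<in> V \<and> w \<in> W \<and> x = u + v + w)"


section \<open>Boundary systems\<close>

definition standard_symmetric_form ::
  "'a::complex_inner \<times> 'a \<Rightarrow> 'a \<times> 'a \<Rightarrow> complex" where
  "standard_symmetric_form = (\<lambda>(x, y) (u, v). cinner x v + cinner y u)"

definition standard_unitary_form ::
  "'a::complex_inner \<times> 'b::complex_inner \<Rightarrow> 'a \<times> 'b \<Rightarrow> complex" where
  "standard_unitary_form = (\<lambda>(x, y) (u, v). cinner x u - cinner y v)"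

text \<open>Only the values of \<open>F\<close> on the graph of the adjoint and those of \<open>\<omega>\<close> on \<open>G1 \<times> G2\<close> matter.\<close>

definition boundary_system ::
  "('h::chilbert_space \<times> 'h) set \<Rightarrow> ('h \<times> 'h \<Rightarrow> 'h \<times> 'h \<Rightarrow> complex) \<Rightarrow>
   'a::complex_inner set \<Rightarrow> 'b::complex_inner set \<Rightarrow>
   ('h \<times> 'h \<Rightarrow> 'a \<times> 'b) \<Rightarrow> ('a \<times> 'b \<Rightarrow> 'a \<times> 'b \<Rightarrow> complex) \<Rightarrow> bool" where
  "boundary_system H0 \<Omega> G1 G2 F \<omega> \<longleftrightarrow>
    sesquilinear_on UNIV \<Omega> \<and>
    hilbert_on G1 \<and> hilbert_on G2 \<and>
    sesquilinear_on (G1 \<times> G2) \<omega> \<and>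
    F ` adjoint_op H0 = G1 \<times> G2 \<and>
    (\<forall>x\<in>Domain (adjoint_op H0). \<forall>y\<in>Domain (adjoint_op H0).
      \<Omega> (x, app (adjoint_op H0) x) (y, app (adjoint_op H0) y) =
      \<omega> (F (x, app (adjoint_op H0) x)) (F (y, app (adjoint_op H0) y)))"

end

theory Submission
  imports Defs
begin

text \<open>In the graph norm, \<open>- H\<^sub>0\<close> is a closed subspace of \<open>H\<^sub>0\<^sup>\<star>\<close>, and \<open>(a, b)\<close> lies in its
  orthogonal complement in \<open>H \<oplus> H\<close> if and only if \<open>(b, a) \<in> H\<^sub>0\<^sup>\<star>\<close>. Splitting an element \<open>(a, b)\<close>
  of \<open>H\<^sub>0\<^sup>\<star>\<close> of this kind as \<open>(g, g) + (h, - h)\<close> with \<open>g = (a + b) / 2\<close>, \<open>h = (a - b) / 2\<close> gives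
  \<open>g \<in> G\<^sub>1\<close>, \<open>h \<in> G\<^sub>2\<close>, hence the von Neumann decomposition of \<open>D(H\<^sub>0\<^sup>\<star>)\<close>. The symmetric form
  vanishes when one argument is in \<open>- H\<^sub>0\<close>, so only the components in \<open>G\<^sub>1\<close>, \<open>G\<^sub>2\<close> contribute.\<close>

section \<open>Orthogonal projection onto a closed real subspace\<close>

text \<open>A minimizing sequence for the distance from \<open>z\<close> to \<open>S\<close> is
  Cauchy by the parallelogram law. Its limit attains the distance, and the first variation at a
  minimizer gives orthogonality.\<close>

lemma orthogonal_projection_exists:
  fixes S :: "'a::{real_inner, complete_space} set"
  assumes S: "subspace S" "closed S"
  obtains p where "p \<in> S" "\<And>y. y \<in> S \<Longrightarrow> inner (z - p) y = 0"
proof -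
  define d where "d = (INF y\<in>S. (norm (z - y))\<^sup>2)"
  have S0: "S \<noteq> {}"
    using S(1) subspace_0 by blast
  have bdd: "bdd_below ((\<lambda>y. (norm (z - y))\<^sup>2) ` S)"
    by (rule bdd_belowI2[of _ 0]) simp
  have lower: "d \<le> (norm (z - y))\<^sup>2" if "y \<in> S" for y
    unfolding d_def using bdd that by (rule cINF_lower)
  have "\<exists>y\<in>S. (norm (z - y))\<^sup>2 < d + 1 / Suc n" for n
    using cINF_less_iff[OF S0 bdd, of "d + 1 / Suc n"] unfolding d_def by simp
  then obtain f where f: "\<And>n. f n \<in> S" "\<And>n. (norm (z - f n))\<^sup>2 < d + 1 / Suc n"
    by metis
  have close: "(norm (f m - f n))\<^sup>2 < 2 / Suc m + 2 / Suc n" for m n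
  proof -
    have "(1/2) *\<^sub>R (f m + f n) \<in> S"
      using S(1) f(1) by (intro subspace_mul subspace_add)
    then have "d \<le> (norm (z - (1/2) *\<^sub>R (f m + f n)))\<^sup>2"
      by (rule lower)
    \<comment> \<open>Parallelogram law for \<open>z - f m\<close> and \<open>z - f n\<close>, whose
      sum is twice the distance vector to the midpoint. The midpoint lies in \<open>S\<close>, so
      the subtracted term is at least \<open>4 * d\<close>.\<close>
    moreover have "(norm (f m - f n))\<^sup>2 =
        2 * (norm (z - f m))\<^sup>2 + 2 * (norm (z - f n))\<^sup>2 - 4 * (norm (z - (1/2) *\<^sub>R (f m + f n)))\<^sup>2"
      by (simp add: power2_norm_eq_inner algebra_simps inner_commute)
    ultimately show ?thesis
      using f(2)[of m] f(2)[of n] by simp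
  qed
  have "Cauchy f"
  proof (rule CauchyI)
    fix e :: real assume "0 < e"
    \<comment> \<open>The factor 4 absorbs the two bounds \<open>2 / Suc N\<close> that
      \<open>close\<close> yields for indices beyond \<open>N\<close>.\<close>
    then have "0 < e\<^sup>2 / 4" by simp
    then obtain N where N: "1 / real (Suc N) < e\<^sup>2 / 4"
      using nat_approx_posE by blast
    have "norm (f m - f n) < e" if "N \<le> m" "N \<le> n" for m n
    proof (rule power2_less_imp_less)
      have "2 / real (Suc m) \<le> 2 / Suc N" "2 / real (Suc n) \<le> 2 / Suc N"
        using that by (auto intro!: divide_left_mono)
      then show "(norm (f m - f n))\<^sup>2 < e\<^sup>2"
        using close[of m n] N by simp
    qed (use \<open>0 < e\<close> in simp)
    then show "\<exists>N. \<forall>m\<ge>N. \<forall>n\<ge>N. norm (f m - f n) < e" by blast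
  qed
  then obtain p where p: "f \<longlonglongrightarrow> p"
    using Cauchy_convergent convergent_def by blast
  have pS: "p \<in> S"
    using S(2) f(1) p closed_sequentially by blast
  have "(\<lambda>n. (norm (z - f n))\<^sup>2) \<longlonglongrightarrow> (norm (z - p))\<^sup>2"
    using p by (intro tendsto_intros)
  moreover have "(\<lambda>n. d + 1 / real (Suc n)) \<longlonglongrightarrow> d + 0"
    by (intro tendsto_add tendsto_const LIMSEQ_Suc lim_1_over_n)
  ultimately have min: "(norm (z - p))\<^sup>2 \<le> d"
    using f(2) by (intro LIMSEQ_le) (auto intro: less_imp_le)
  have "inner (z - p) y = 0" if "y \<in> S" for y
  proof (rule ccontr)
    assume nz: "inner (z - p) y \<noteq> 0"
    \<comment> \<open>This \<open>t\<close> minimizes the quadratic polynomial giving the squared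
      distance from \<open>z\<close> to \<open>p + t *\<^sub>R y\<close>; a nonzero inner product
      would make that distance smaller than the minimum.\<close>
    define t where "t = inner (z - p) y / inner y y"
    have yy: "inner y y > 0" using nz by auto
    have "p + t *\<^sub>R y \<in> S"
      using S(1) pS that by (intro subspace_add subspace_mul)
    then have "(norm (z - p))\<^sup>2 \<le> (norm (z - (p + t *\<^sub>R y)))\<^sup>2"
      using lower min order_trans by blast
    also have "\<dots> = (norm (z - p))\<^sup>2 - 2 * t * inner (z - p) y + t * (t * inner y y)"
      by (simp add: power2_norm_eq_inner algebra_simps inner_commute)
    also have "t * inner y y = inner (z - p) y"
      using yy by (simp add: t_def)
    finally have "t * inner (z - p) y \<le> 0" by simp
    moreover have "t * inner (z - p) y > 0"
      using yy nz by (simp add: t_def zero_less_divide_iff zero_less_mult_iff) (auto simp: linorder_neq_iff)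
    ultimately show False by simp
  qed
  with pS show thesis using that by blast
qed

section \<open>Algebra of the complex inner product and complex subspaces\<close>

lemma cinner_add_right: "cinner x (y + z) = cinner x y + cinner x z"
  by (metis cinner_add_left cinner_commute complex_cnj_add)

lemma cinner_scaleC_right: "cinner x (c *\<^sub>C y) = cnj c * cinner x y"
  by (metis cinner_scaleC_left cinner_commute complex_cnj_mult)

lemma cinner_scaleR_left: "cinner (r *\<^sub>R x) y = of_real r * cinner x y"
  by (metis cinner_scaleC_left scaleC_of_real)

lemma cinner_scaleR_right: "cinner x (r *\<^sub>R y) = of_real r * cinner x y"
  by (metis cinner_scaleC_right scaleC_of_real complex_cnj_complex_of_real)

lemma cinner_zero_right: "cinner x 0 = 0"
  using cinner_scaleR_right[of x 0 0] by simp

lemma cinner_minus_left: "cinner (- x) y = - cinner x y"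
  using cinner_scaleR_left[of "-1" x y] by simp

lemma cinner_minus_right: "cinner x (- y) = - cinner x y"
  using cinner_scaleR_right[of x "-1" y] by simp

lemma cinner_diff_left: "cinner (x - y) z = cinner x z - cinner y z"
  using cinner_add_left[of x "- y" z] by (simp add: cinner_minus_left)

lemma cinner_diff_right: "cinner x (y - z) = cinner x y - cinner x z"
  using cinner_add_right[of x y "- z"] by (simp add: cinner_minus_right)

lemmas cinner_simps = cinner_zero_right cinner_add_left cinner_add_right cinner_diff_left
  cinner_diff_right cinner_minus_left cinner_minus_right cinner_scaleR_left cinner_scaleR_right
  cinner_scaleC_left cinner_scaleC_right

lemma csubspace_imp_subspace:
  fixes S :: "'a::complex_vector set"
  assumes "csubspace S"
  shows "subspace S"
proof -
  have "r *\<^sub>R x \<in> S" if "x \<in> S" for r x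
    using complex_vector.subspace_scale[OF assms that, of "of_real r"] by (simp add: scaleC_of_real)
  then show ?thesis
    using complex_vector.subspace_0[OF assms] complex_vector.subspace_add[OF assms]
    by (simp add: subspace_def)
qed

section \<open>Linearity, closedness and single-valuedness of the adjoint\<close>

text \<open>Real parts suffice because \<open>A\<close> is closed under multiplication by
  \<open>\<i>\<close>: testing with that multiple of \<open>(x, y)\<close> recovers the imaginary
  parts. This makes real orthogonal projections usable for the complex adjoint.\<close>

lemma mem_adjoint_op_iff_inner:
  assumes "csubspace A"
  shows "(u, v) \<in> adjoint_op A \<longleftrightarrow> (\<forall>(x, y)\<in>A. inner y u = inner x v)"
proof
  assume "(u, v) \<in> adjoint_op A"
  then show "\<forall>(x, y)\<in>A. inner y u = inner x v"
    by (auto simp: adjoint_op_def simp flip: Re_cinner)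
next
  assume re: "\<forall>(x, y)\<in>A. inner y u = inner x v"
  have "cinner y u = cinner x v" if "(x, y) \<in> A" for x y
  proof (rule complex_eqI)
    show "Re (cinner y u) = Re (cinner x v)"
      using re that by (auto simp: Re_cinner)
    have "(\<i> *\<^sub>C x, \<i> *\<^sub>C y) \<in> A"
      using complex_vector.subspace_scale[OF assms that, of \<i>] by (simp add: scaleC_prod_def)
    then have "Re (cinner (\<i> *\<^sub>C y) u) = Re (cinner (\<i> *\<^sub>C x) v)"
      using re by (auto simp: Re_cinner)
    then show "Im (cinner y u) = Im (cinner x v)"
      by (simp add: cinner_scaleC_left)
  qed
  then show "(u, v) \<in> adjoint_op A"
    by (auto simp: adjoint_op_def)
qed

lemma csubspace_adjoint_op: "csubspace (adjoint_op A)"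
  unfolding complex_vector.subspace_def adjoint_op_def
  by (auto simp: scaleC_prod_def cinner_simps zero_prod_def split_beta)

text \<open>The real form of the adjoint condition presents the graph as an intersection of closed
  sets, one for each element of \<open>A\<close>.\<close>

lemma closed_adjoint_op:
  assumes "csubspace A"
  shows "closed (adjoint_op A)"
proof -
  have "adjoint_op A = (\<Inter>(x, y)\<in>A. {p. inner y (fst p) = inner x (snd p)})"
    using mem_adjoint_op_iff_inner[OF assms] by (fastforce simp: split_beta)
  moreover have "closed {p. inner y (fst p) = inner x (snd p)}" for x :: 'a and y :: 'b
    by (intro closed_Collect_eq continuous_intros)
  ultimately show ?thesis
    by (auto intro!: closed_INT)
qed

text \<open>The difference of two values at the same point is orthogonal to the dense domain of
  \<open>A\<close>, hence by continuity to itself.\<close>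

lemma single_valued_adjoint_op:
  assumes "densely_defined A"
  shows "single_valued (adjoint_op A)"
proof (rule single_valuedI)
  fix u v w assume v: "(u, v) \<in> adjoint_op A" and w: "(u, w) \<in> adjoint_op A"
  have "Domain A \<subseteq> {x. inner x (v - w) = 0}"
  proof
    fix x assume "x \<in> Domain A"
    then have "cinner x v = cinner x w"
      using v w by (force simp: adjoint_op_def)
    then have "inner x v = inner x w"
      by (metis Re_cinner)
    then show "x \<in> {x. inner x (v - w) = 0}"
      by (simp add: inner_diff_right)
  qed
  moreover have "closed {x. inner x (v - w) = 0}"
    by (intro closed_Collect_eq continuous_intros)
  ultimately have "closure (Domain A) \<subseteq> {x. inner x (v - w) = 0}"
    by (rule closure_minimal)
  then have "v - w \<in> {x. inner x (v - w) = 0}"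
    using assms unfolding densely_defined_def by blast
  then show "v = w" by simp
qed

section \<open>The two kernels as Hilbert spaces, and the standard forms\<close>

lemma app_eqI:
  assumes "single_valued A" "(x, y) \<in> A"
  shows "app A x = y"
  unfolding app_def using assms by (blast dest: single_valuedD)

lemma op_ker_Id_minus: "op_ker (op_minus Id A) = {x. (x, x) \<in> A}"
  by (auto simp: op_ker_def op_minus_def)

lemma op_ker_Id_plus:
  fixes A :: "('a::ab_group_add \<times> 'a) set"
  shows "op_ker (op_plus Id A) = {x. (x, - x) \<in> A}"
  by (force simp: op_ker_def op_plus_def dest: minus_unique)

text \<open>Both sets are preimages of the closed graph under the continuous linear maps sending
  \<open>x\<close> to \<open>(x, x)\<close> and to \<open>(x, - x)\<close>; closed subsets of a
  complete space are complete.\<close>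

lemma hilbert_on_eigenspaces:
  fixes A :: "('h::chilbert_space \<times> 'h) set"
  assumes A: "csubspace A" "closed A"
  shows "hilbert_on {x. (x, x) \<in> A}" "hilbert_on {x. (x, - x) \<in> A}"
proof -
  note subspace = complex_vector.subspace_0[OF A(1)] complex_vector.subspace_add[OF A(1)]
    complex_vector.subspace_scale[OF A(1)]
  have "csubspace {x. (x, x) \<in> A}"
    unfolding complex_vector.subspace_def
    using subspace(1) subspace(2)[of "(x, x)" "(y, y)" for x y] subspace(3)[of "(x, x)" for x]
    by (simp add: zero_prod_def scaleC_prod_def)
  moreover have "csubspace {x. (x, - x) \<in> A}"
    unfolding complex_vector.subspace_def
    using subspace(1) subspace(2)[of "(x, - x)" "(y, - y)" for x y] subspace(3)[of "(x, - x)" for x]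
    by (simp add: zero_prod_def scaleC_prod_def)
  moreover have "closed ((\<lambda>x. (x, x)) -` A)" "closed ((\<lambda>x. (x, - x)) -` A)"
    by (intro continuous_closed_vimage A(2) continuous_intros)+
  ultimately show "hilbert_on {x. (x, x) \<in> A}" "hilbert_on {x. (x, - x) \<in> A}"
    by (auto simp: hilbert_on_def complete_eq_closed vimage_def)
qed

lemma sesquilinear_on_standard_symmetric_form: "sesquilinear_on UNIV standard_symmetric_form"
  by (auto simp: sesquilinear_on_def standard_symmetric_form_def scaleC_prod_def cinner_simps
      algebra_simps complex_vector.subspace_UNIV)

lemma sesquilinear_on_standard_unitary_form:
  assumes "csubspace G1" "csubspace G2"
  shows "sesquilinear_on (G1 \<times> G2) standard_unitary_form"
proof -
  have "csubspace (G1 \<times> G2)"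
    using assms by (auto simp: complex_vector.subspace_def scaleC_prod_def zero_prod_def)
  then show ?thesis
    by (auto simp: sesquilinear_on_def standard_unitary_form_def scaleC_prod_def cinner_simps
        algebra_simps)
qed

section \<open>Existence and uniqueness of the von Neumann decomposition\<close>

text \<open>The equation for \<open>v\<close> records how the adjoint acts on the three summands: as
  minus \<open>H0\<close>, as the identity and as minus the identity. The boundary identity needs
  both entries of the graph element.\<close>

lemma von_Neumann_decomposition_exists:
  fixes H0 :: "('h::chilbert_space \<times> 'h) set"
  assumes "csubspace H0" "closed H0" and skew: "skew_symmetric H0"
    and uv: "(u, v) \<in> adjoint_op H0"
  obtains x y g h where "(x, y) \<in> H0" "(g, g) \<in> adjoint_op H0" "(h, - h) \<in> adjoint_op H0"
    "u = x + g + h" "v = - y + g - h"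
proof -
  let ?K = "adjoint_op H0"
  \<comment> \<open>\<open>M\<close> is the graph of \<open>- H0\<close>. Projecting
    \<open>(u, v)\<close> onto it gives \<open>p = (x, - y)\<close> with residual
    \<open>(a, b)\<close>.\<close>
  define M where "M = {p. (fst p, - snd p) \<in> H0}"
  have subH: "subspace H0" and subK: "subspace ?K"
    using assms(1) csubspace_adjoint_op csubspace_imp_subspace by blast+
  have "subspace M"
    unfolding subspace_def M_def
    using subspace_0[OF subH] subspace_add[OF subH, of "(x, - y)" "(x', - y')" for x y x' y']
      subspace_scale[OF subH, of "(x, - y)" for x y]
    by (simp add: zero_prod_def)
  moreover have "closed M"
  proof -
    have "closed ((\<lambda>p. (fst p, - snd p)) -` H0)"
      by (intro continuous_closed_vimage assms(2) continuous_intros)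
    then show ?thesis by (simp add: M_def vimage_def)
  qed
  ultimately obtain p where p: "p \<in> M" and orth: "\<And>q. q \<in> M \<Longrightarrow> inner ((u, v) - p) q = 0"
    using orthogonal_projection_exists by blast
  define x y a b where "x = fst p" and "y = - snd p" and "a = u - x" and "b = v + y"
  have xy: "(x, y) \<in> H0"
    using p by (simp add: M_def x_def y_def)
  then have "(x, - y) \<in> ?K"
    using skew by (force simp: skew_symmetric_def op_uminus_def)
  then have ab: "(a, b) \<in> ?K"
    using subspace_diff[OF subK uv, of "(x, - y)"] by (simp add: a_def b_def)
  \<comment> \<open>Orthogonality of \<open>(a, b)\<close> to \<open>(r, - s)\<close> is exactly the
    adjoint condition for the swapped pair \<open>(b, a)\<close>.\<close>
  have "inner s b = inner r a" if "(r, s) \<in> H0" for r s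
  proof -
    have "inner ((u, v) - p) (r, - s) = 0"
      using that by (intro orth) (simp add: M_def)
    moreover have "(u, v) - p = (a, b)"
      by (simp add: a_def b_def x_def y_def prod_eq_iff)
    ultimately show ?thesis
      by (simp add: inner_commute)
  qed
  then have ba: "(b, a) \<in> ?K"
    using mem_adjoint_op_iff_inner[OF assms(1)] by auto
  define g h where "g = (1/2) *\<^sub>R (a + b)" and "h = (1/2) *\<^sub>R (a - b)"
  have "(g, g) = (1/2) *\<^sub>R ((a, b) + (b, a))" "(h, - h) = (1/2) *\<^sub>R ((a, b) - (b, a))"
    by (simp_all add: g_def h_def algebra_simps)
  then have "(g, g) \<in> ?K" "(h, - h) \<in> ?K"
    using subspace_scale[OF subK subspace_add[OF subK ab ba]]
      subspace_scale[OF subK subspace_diff[OF subK ab ba]] by metis+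
  moreover have "g + h = (1/2) *\<^sub>R (a + a)" "g - h = (1/2) *\<^sub>R (b + b)"
    by (simp_all add: g_def h_def algebra_simps)
  then have "g + h = a" "g - h = b"
    by (simp_all only: scaleR_half_double)
  then have "u = x + g + h" "v = - y + g - h"
    by (simp_all add: a_def b_def algebra_simps)
  ultimately show thesis
    using xy that by blast
qed

text \<open>Single-valuedness at 0 turns the relation among first entries into one among second
  entries, so \<open>x\<close> and \<open>y\<close> are both expressed by \<open>g\<close> and
  \<open>h\<close>. Then \<open>(y, - x)\<close> lies in the adjoint, and pairing it with
  \<open>(x, y)\<close> makes a sum of two squared norms vanish.\<close>

lemma von_Neumann_decomposition_trivial:
  fixes H0 :: "('h::chilbert_space \<times> 'h) set"
  assumes skew: "skew_symmetric H0" and sv: "single_valued (adjoint_op H0)"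
    and xy: "(x, y) \<in> H0" and g: "(g, g) \<in> adjoint_op H0" and h: "(h, - h) \<in> adjoint_op H0"
    and sum0: "x + g + h = 0"
  shows "g = 0" "h = 0"
proof -
  let ?K = "adjoint_op H0"
  have subK: "subspace ?K"
    by (intro csubspace_imp_subspace csubspace_adjoint_op)
  have "(x, - y) \<in> ?K"
    using skew xy by (force simp: skew_symmetric_def op_uminus_def)
  from subspace_add[OF subK this subspace_add[OF subK g h]]
  have "(0, - y + g - h) \<in> ?K"
    using sum0 by (simp add: algebra_simps)
  moreover have "(0, 0) \<in> ?K"
    using subspace_0[OF subK] by (simp add: zero_prod_def)
  ultimately have "- y + g - h = 0"
    using sv by (blast dest: single_valuedD)
  then have y: "y = g - h"
    by (simp add: algebra_simps)
  have x: "x = - (g + h)"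
    using sum0 by (metis add.assoc add_eq_0_iff2)
  \<comment> \<open>The difference of \<open>(g, g)\<close> and \<open>(h, - h)\<close> is
    \<open>(g - h, g + h)\<close>, which is this pair.\<close>
  have "(y, - x) \<in> ?K"
    using subspace_diff[OF subK g h] by (simp add: x y add.commute)
  then have "cinner y y = cinner x (- x)"
    using xy by (auto simp: adjoint_op_def)
  then have "Re (cinner y y) = Re (cinner x (- x))"
    by simp
  then have "inner y y + inner x x = 0"
    unfolding Re_cinner by simp
  then have "y = 0" "x = 0"
    by (simp_all add: add_nonneg_eq_0_iff)
  with x y have "g = h" "g + g = 0"
    by (metis eq_iff_diff_eq_0 neg_0_equal_iff_equal)+
  then show "g = 0" "h = 0"
    by (metis scaleR_half_double scaleR_zero_right)+
qed

text \<open>Two decompositions of the same vector differ by a decomposition of zero, whose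
  components in the two kernels vanish; the domain components then agree as well.\<close>

lemma direct_sum_components_von_Neumann:
  fixes H0 :: "('h::chilbert_space \<times> 'h) set"
  assumes "csubspace H0" "skew_symmetric H0" "single_valued (adjoint_op H0)"
    and dec: "(x, y) \<in> H0" "(g, g) \<in> adjoint_op H0" "(h, - h) \<in> adjoint_op H0"
  shows "direct_sum_components (Domain H0)
    {u. (u, u) \<in> adjoint_op H0} {u. (u, - u) \<in> adjoint_op H0} (x + g + h) = (x, g, h)"
proof -
  let ?K = "adjoint_op H0"
  have subH: "subspace H0" and subK: "subspace ?K"
    using assms(1) csubspace_adjoint_op csubspace_imp_subspace by blast+
  have "x' = x \<and> g' = g \<and> h' = h"
    if "x' \<in> Domain H0" and g': "(g', g') \<in> ?K" and h': "(h', - h') \<in> ?K"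
      and eq: "x + g + h = x' + g' + h'" for x' g' h'
  proof -
    obtain y' where "(x', y') \<in> H0" using \<open>x' \<in> Domain H0\<close> by blast
    then have "(x - x', y - y') \<in> H0"
      using subspace_diff[OF subH dec(1)] by force
    moreover have "(g - g', g - g') \<in> ?K"
      using subspace_diff[OF subK dec(2) g'] by simp
    moreover have "(h - h', - (h - h')) \<in> ?K"
      using subspace_diff[OF subK dec(3) h'] by simp
    moreover have "(x - x') + (g - g') + (h - h') = 0"
      using eq by (simp add: algebra_simps)
    ultimately have "g - g' = 0" "h - h' = 0"
      using von_Neumann_decomposition_trivial[OF assms(2,3)] by blast+
    then show ?thesis
      using eq by simp
  qed
  then show ?thesis
    unfolding direct_sum_components_def using dec
    by (intro the_equality) (auto simp: Domain_iff)
qed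

section \<open>The boundary identity and the boundary system\<close>

text \<open>Every term involving \<open>(x, - y)\<close> or \<open>(x', - y')\<close> vanishes by
  the adjoint condition. The mixed terms of \<open>g\<close> with \<open>h'\<close> and of
  \<open>h\<close> with \<open>g'\<close> cancel because of the opposite signs, leaving the two
  diagonal terms, each doubled.\<close>

lemma standard_symmetric_form_von_Neumann:
  assumes H0: "(x, y) \<in> H0" "(x', y') \<in> H0" and skew: "skew_symmetric H0"
    and g: "(g, g) \<in> adjoint_op H0" "(g', g') \<in> adjoint_op H0"
    and h: "(h, - h) \<in> adjoint_op H0" "(h', - h') \<in> adjoint_op H0"
  shows "standard_symmetric_form (x + g + h, - y + g - h) (x' + g' + h', - y' + g' - h') =
    2 * cinner g g' - 2 * cinner h h'"
proof -
  have vanish: "cinner y u = cinner x v" if "(x, y) \<in> H0" "(u, v) \<in> adjoint_op H0" for x y u v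
    using that by (auto simp: adjoint_op_def)
  have vanish': "cinner u y = cinner v x" if "(x, y) \<in> H0" "(u, v) \<in> adjoint_op H0" for x y u v
    using vanish[OF that] by (metis cinner_commute)
  \<comment> \<open>Skew-symmetry enters here: it removes the term in which both arguments come from
    \<open>- H0\<close>.\<close>
  have "(x', - y') \<in> adjoint_op H0"
    using skew H0(2) by (force simp: skew_symmetric_def op_uminus_def)
  note this = vanish[OF H0(1) this]
  with vanish[OF H0(1) g(2)] vanish[OF H0(1) h(2)] vanish'[OF H0(2) g(1)] vanish'[OF H0(2) h(1)]
  show ?thesis
    by (simp add: standard_symmetric_form_def cinner_simps algebra_simps)
qed

theorem theorem5:
  fixes H0 :: "('h::chilbert_space \<times> 'h) set"
    and G1 G2 :: "'h set"
    and P1 P2 :: "'h \<Rightarrow> 'h"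
    and F :: "'h \<times> 'h \<Rightarrow> 'h \<times> 'h"
  assumes "linear_operator H0"
    and "densely_defined H0"
    and "closed H0"
    and "skew_symmetric H0"
    and "G1 = op_ker (op_minus Id (adjoint_op H0))"
    and "G2 = op_ker (op_plus Id (adjoint_op H0))"
    and "\<And>x. x \<in> Domain (adjoint_op H0) \<Longrightarrow> P1 x = fst (snd (direct_sum_components (Domain H0) G1 G2 x))"
    and "\<And>x. x \<in> Domain (adjoint_op H0) \<Longrightarrow> P2 x = snd (snd (direct_sum_components (Domain H0) G1 G2 x))"
    and "\<And>x. x \<in> Domain (adjoint_op H0) \<Longrightarrow>
          F (x, app (adjoint_op H0) x) = (sqrt 2 *\<^sub>R P1 x, sqrt 2 *\<^sub>R P2 x)"
  shows "boundary_system H0 standard_symmetric_form G1 G2 F standard_unitary_form"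
proof -
  let ?K = "adjoint_op H0"
  have H0: "csubspace H0"
    using assms(1) by (simp add: linear_operator_def)
  have G1: "G1 = {x. (x, x) \<in> ?K}" and G2: "G2 = {x. (x, - x) \<in> ?K}"
    using assms(5,6) by (simp_all add: op_ker_Id_minus op_ker_Id_plus)
  have hilb: "hilbert_on G1" "hilbert_on G2"
    unfolding G1 G2 using csubspace_adjoint_op closed_adjoint_op[OF H0] hilbert_on_eigenspaces by blast+
  then have sub: "subspace G1" "subspace G2" "csubspace G1" "csubspace G2"
    by (auto simp: hilbert_on_def intro: csubspace_imp_subspace)
  have sv: "single_valued ?K"
    using assms(2) by (rule single_valued_adjoint_op)
  have subK: "subspace ?K"
    by (intro csubspace_imp_subspace csubspace_adjoint_op)
  \<comment> \<open>By uniqueness, any decomposition at hand computes \<open>F\<close>, so the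
    definite descriptions behind \<open>P1\<close> and \<open>P2\<close> can be avoided from here
    on.\<close>
  have F: "F (u, v) = (sqrt 2 *\<^sub>R g, sqrt 2 *\<^sub>R h)"
    if "(u, v) \<in> ?K" "(x, y) \<in> H0" "(g, g) \<in> ?K" "(h, - h) \<in> ?K" "u = x + g + h"
    for u v x y g h
  proof -
    have u: "u \<in> Domain ?K" using that(1) by blast
    have "direct_sum_components (Domain H0) G1 G2 u = (x, g, h)"
      unfolding G1 G2 that(5) using that by (intro direct_sum_components_von_Neumann H0 assms(4) sv)
    then show ?thesis
      using assms(9)[OF u] assms(7)[OF u] assms(8)[OF u] app_eqI[OF sv that(1)] by simp
  qed
  have "F ` ?K = G1 \<times> G2"
  proof
    show "F ` ?K \<subseteq> G1 \<times> G2"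
    proof (clarify)
      fix u v g' h' assume uv: "(u, v) \<in> ?K" and Fuv: "(g', h') = F (u, v)"
      obtain x y g h where dec: "(x, y) \<in> H0" "(g, g) \<in> ?K" "(h, - h) \<in> ?K" "u = x + g + h"
        using von_Neumann_decomposition_exists[OF H0 assms(3,4) uv] by metis
      then have "g \<in> G1" "h \<in> G2"
        by (simp_all add: G1 G2)
      then show "g' \<in> G1 \<and> h' \<in> G2"
        using F[OF uv dec] Fuv sub(1,2) by (simp add: subspace_scale)
    qed
    show "G1 \<times> G2 \<subseteq> F ` ?K"
    proof clarify
      fix g' h' assume "g' \<in> G1" "h' \<in> G2"
      \<comment> \<open>The scaling cancels the factor \<open>sqrt 2\<close> in \<open>F\<close>.
        The preimage is \<open>(g + h, g - h)\<close>, whose component in the domain of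
        \<open>H0\<close> is zero.\<close>
      define g h where "g = (1 / sqrt 2) *\<^sub>R g'" and "h = (1 / sqrt 2) *\<^sub>R h'"
      have g: "(g, g) \<in> ?K" and h: "(h, - h) \<in> ?K"
        using subspace_scale[OF sub(1) \<open>g' \<in> G1\<close>, of "1 / sqrt 2"]
          subspace_scale[OF sub(2) \<open>h' \<in> G2\<close>, of "1 / sqrt 2"]
        unfolding g_def h_def G1 G2 by blast+
      have gh: "(g + h, g - h) \<in> ?K"
        using subspace_add[OF subK g h] by simp
      have "(0, 0) \<in> H0"
        using complex_vector.subspace_0[OF H0] by (simp add: zero_prod_def)
      then have "F (g + h, g - h) = (sqrt 2 *\<^sub>R g, sqrt 2 *\<^sub>R h)"
        using F[OF gh _ g h] by simp
      then show "(g', h') \<in> F ` ?K"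
        using gh by (force simp: g_def h_def)
    qed
  qed
  moreover have "standard_symmetric_form (u, app ?K u) (u', app ?K u') =
      standard_unitary_form (F (u, app ?K u)) (F (u', app ?K u'))"
    if dom: "u \<in> Domain ?K" "u' \<in> Domain ?K" for u u'
  proof -
    obtain v v' where v: "(u, v) \<in> ?K" and v': "(u', v') \<in> ?K"
      using dom by blast
    obtain x y g h where dec: "(x, y) \<in> H0" "(g, g) \<in> ?K" "(h, - h) \<in> ?K"
        "u = x + g + h" "v = - y + g - h"
      using von_Neumann_decomposition_exists[OF H0 assms(3,4) v] by metis
    obtain x' y' g' h' where dec': "(x', y') \<in> H0" "(g', g') \<in> ?K" "(h', - h') \<in> ?K"
        "u' = x' + g' + h'" "v' = - y' + g' - h'"
      using von_Neumann_decomposition_exists[OF H0 assms(3,4) v'] by metis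
    have "standard_symmetric_form (u, v) (u', v') = 2 * cinner g g' - 2 * cinner h h'"
      unfolding dec(4,5) dec'(4,5)
      using dec(1-3) dec'(1-3) assms(4) by (intro standard_symmetric_form_von_Neumann)
    \<comment> \<open>One \<open>sqrt 2\<close> from each argument of the unitary form produces the
      factor 2 of the symmetric form.\<close>
    moreover have "complex_of_real (sqrt 2) * complex_of_real (sqrt 2) = 2"
      by (simp flip: of_real_mult)
    ultimately show ?thesis
      using F[OF v dec(1-4)] F[OF v' dec'(1-4)]
      by (simp add: app_eqI[OF sv v] app_eqI[OF sv v'] standard_unitary_form_def cinner_simps
          flip: mult.assoc)
  qed
  ultimately show ?thesis
    using hilb sub by (simp add: boundary_system_def sesquilinear_on_standard_symmetric_form
        sesquilinear_on_standard_unitary_form)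
qed

end
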